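(* For integers $n\ge 1$ let $L_1(n)=2^{2n}+2^n+1$. Then: (1) the numbers $L_1(1)=7$, $L_1(3)=73$ and $L_1(9)=262657$ are prime; (2) if $n\ge 1$ is an integer that is not of the form $n=3^k$ with $k\ge 0$ an integer, then $L_1(n)$ is composite.
   Context: A composite number is an integer greater than $1$ that is not prime. *)

theory Defs
  imports "HOL-Computational_Algebra.Primes"
begin

definition composite :: "nat \<Rightarrow> bool" where
  "composite m \<longleftrightarrow> m > 1 \<and> \<not> prime m"

definition L1 :: "nat \<Rightarrow> nat" where
  "L1 n = 2 ^ (2 * n) + 2 ^ n + 1"

end

theory Submission
  imports Defs "HOL-Number_Theory.Pocklington"
begin

text \<open>
  If \<open>3\<close> does not divide \<open>m\<close>, the primitive cube roots of unity are roots of \<open>x\<^sup>2\<^sup>m + x\<^sup>m + 1\<close>, so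
  this polynomial is divisible by \<open>x\<^sup>2 + x + 1\<close>.  Writing \<open>n = 3\<^sup>k m\<close> with \<open>3\<close> not dividing \<open>m\<close>
  and putting \<open>x = 2 ^ 3\<^sup>k\<close> shows that \<open>L1 (3\<^sup>k)\<close> divides \<open>L1 n\<close>, properly as soon as \<open>m > 1\<close>.
\<close>

lemma cyclotomic3_dvd_power:
  fixes x :: "'a::comm_ring_1"
  assumes "\<not> 3 dvd m"
  shows "x ^ 2 + x + 1 dvd x ^ (2 * m) + x ^ m + 1"
  using assms
proof (induction m rule: less_induct)
  case (less m)
  consider "m = 1" | "m = 2" | j where "m = j + 3"
    using less.prems le_Suc_ex[of 3 m] by (cases "m \<ge> 3") (auto simp: not_le less_Suc_eq eval_nat_numeral)
  then show ?case
  proof cases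
    case 1
    then show ?thesis by simp
  next
    case 2
    have "x ^ 4 + x ^ 2 + 1 = (x ^ 2 + x + 1) * (x ^ 2 - x + 1)"
      by (simp add: algebra_simps power2_eq_square power4_eq_xxxx)
    then show ?thesis using 2 by simp
  next
    case (3 j)
    have "\<not> 3 dvd j" using less.prems 3 by simp
    then have IH: "x ^ 2 + x + 1 dvd x ^ (2 * j) + x ^ j + 1"
      using less.IH 3 by simp
    \<comment> \<open>Lowering \<open>m\<close> by 3 changes nothing modulo
      \<open>x ^ 2 + x + 1\<close>: the difference is a multiple of \<open>x ^ 3 - 1\<close>, which
      is \<open>(x - 1) * (x ^ 2 + x + 1)\<close>.\<close>
    have "x ^ (2 * m) + x ^ m + 1 = (x ^ (2 * j) + x ^ j + 1)
        + (x ^ 2 + x + 1) * ((x - 1) * (x ^ j * x ^ j * (x ^ 3 + 1) + x ^ j))"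
      by (simp add: 3 algebra_simps power_add mult_2 eval_nat_numeral)
    then show ?thesis using IH by (metis dvd_add dvd_triv_left)
  qed
qed

lemma L1_dvd_L1_mult:
  assumes "\<not> 3 dvd m"
  shows "L1 a dvd L1 (a * m)"
proof -
  \<comment> \<open>The polynomial divisibility uses subtraction, hence the detour through the
    integers.\<close>
  have "int (L1 a) dvd int (L1 (a * m))"
    using cyclotomic3_dvd_power[OF assms, of "2 ^ a :: int"]
    by (simp add: L1_def flip: power_mult) (simp add: ac_simps)
  then show ?thesis by (simp only: of_nat_dvd_iff)
qed

lemma L1_less_L1:
  assumes "a < b"
  shows "L1 a < L1 b"
  using assms by (simp add: L1_def add_strict_mono)

text \<open>
  Since \<open>511 * 262657 = 2\<^sup>2\<^sup>7 - 1\<close>, the order of \<open>2\<close> modulo a prime divisor \<open>p\<close> is \<open>27\<close>.  Hence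
  \<open>p\<close> is \<open>1\<close> modulo \<open>54\<close>, which leaves few candidates up to the square root.
\<close>

lemma prime_262657: "prime (262657::nat)"
proof (subst prime_prime_factor_sqrt, intro conjI notI)
  assume "\<exists>p::nat. prime p \<and> p dvd 262657 \<and> p\<^sup>2 \<le> 262657"
  then obtain p :: nat where p: "prime p" "p dvd 262657" "p\<^sup>2 \<le> 262657" by blast
  have "odd p"
  proof
    assume "even p"
    then have "2 dvd (262657::nat)" using p(2) by (rule dvd_trans)
    then show False by simp
  qed
  \<comment> \<open>513 is the least integer whose square exceeds 262657.\<close>
  have "p < 513"
    using p(3) power_less_imp_less_base[of p 2 513] by simp
  have dvd: "p dvd 2 ^ e - 1 \<longleftrightarrow> ord p 2 dvd e" for e
    unfolding ord_divides[symmetric] by (simp add: cong_altdef_nat)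
  have "p dvd 511 * 262657"
    using p(2) by (rule dvd_mult)
  then have "p dvd 2 ^ 27 - 1" by simp
  \<comment> \<open>Coprimality of 511 and 262657 excludes the orders 1, 3 and 9 at once.\<close>
  moreover have "\<not> p dvd 2 ^ 9 - 1"
  proof
    assume "p dvd 2 ^ 9 - 1"
    then have "p dvd gcd 262657 (2 ^ 9 - 1)"
      using p(2) by (intro gcd_greatest)
    also have "gcd 262657 (2 ^ 9 - 1) = (1::nat)"
      by (simp add: gcd_non_0_nat)
    finally show False
      using p(1) by simp
  qed
  ultimately have ord: "ord p 2 dvd 3 ^ 3" "\<not> ord p 2 dvd 3\<^sup>2"
    unfolding dvd by simp_all
  have three: "prime (3::nat)" by simp
  obtain i where i: "i \<le> 3" "ord p 2 = 3 ^ i"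
    using ord(1) divides_primepow_nat[OF three] by blast
  have "\<not> i \<le> 2"
    using ord(2) i(2) le_imp_power_dvd[of i 2 "3::nat"] by metis
  then have "i = 3" using i(1) by linarith
  then have "ord p 2 = 27" using i(2) by simp
  moreover have "ord p 2 dvd p - 1"
    using order_divides_totient[of p 2] \<open>odd p\<close> p(1) by (simp add: totient_prime)
  ultimately have "27 dvd p - 1" by simp
  moreover have "2 dvd p - 1" using \<open>odd p\<close> by simp
  ultimately have "27 * 2 dvd p - 1" by (intro divides_mult) simp_all
  then obtain k where "p - 1 = 54 * k" by auto
  then have k: "p = 54 * k + 1"
    using prime_gt_1_nat[OF p(1)] by linarith
  then have "k < 10"
    using \<open>p < 513\<close> by linarith
  then have "k \<in> {0, 1, 2, 3, 4, 5, 6, 7, 8, 9}"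
    by (simp only: insert_iff empty_iff) presburger
  then have "p \<in> {1, 55, 109, 163, 217, 271, 325, 379, 433, 487}"
    using k by (elim insertE emptyE) simp_all
  moreover have "p \<noteq> 1"
    using p(1) by auto
  \<comment> \<open>Trial division by the nine remaining candidates, composite ones
    included.\<close>
  ultimately show False
    using p(2) by (elim insertE emptyE; simp)
qed simp_all

lemma composite_L1:
  assumes "n \<ge> 1" and "\<nexists>k. n = 3 ^ k"
  shows "composite (L1 n)"
proof -
  obtain k m where n: "n = 3 ^ k * m" and m: "\<not> 3 dvd m"
    using multiplicity_decompose'[of n 3] assms(1)
    by (metis nat_dvd_1_iff_1 not_one_le_zero numeral_eq_one_iff semiring_norm(86))
  \<comment> \<open>If \<open>m\<close> were 1, then \<open>n\<close> would be a power of 3; so the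
    divisor found below is proper.\<close>
  have "m \<noteq> 0" "m \<noteq> 1" using n assms by auto
  then have "L1 (3 ^ k) < L1 n" by (intro L1_less_L1) (simp add: n)
  moreover have "L1 (3 ^ k) dvd L1 n" unfolding n by (rule L1_dvd_L1_mult[OF m])
  moreover have "L1 (3 ^ k) > 1" by (simp add: L1_def)
  ultimately show ?thesis
    using prime_nat_not_dvd[of "L1 n" "L1 (3 ^ k)"] by (auto simp only: composite_def)
qed

theorem theorem2:
  shows "((L1 1 = 7 \<and> prime (L1 1)) \<and> (L1 3 = 73 \<and> prime (L1 3)) \<and> (L1 9 = 262657 \<and> prime (L1 9)))
    \<and> (\<forall>n::nat. n \<ge> 1 \<and> \<not> (\<exists>k::nat. n = 3 ^ k) \<longrightarrow> composite (L1 n))"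
proof -
  have L1_values: "L1 1 = 7" "L1 3 = 73" "L1 9 = 262657"
    by (simp_all add: L1_def)
  have "prime (7::nat)" "prime (73::nat)"
    by simp_all
  then show ?thesis
    using composite_L1 prime_262657 unfolding L1_values by blast
qed

end
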